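(* Let $f,g\in T(X,\mathcal{P})$. Then $(f,g)\in \mathcal{D}$ in $T(X,\mathcal{P})$ if and only if there exist $\gamma\in T(I)$ and a bijection $\varphi\colon \pi(f)\to \pi(g)$ such that: (i) $\left(\chi^{(f)},\gamma\right)\in \mathcal{L}$ and $\left(\gamma,\chi^{(g)}\right)\in \mathcal{R}$ in $T(I)$; and (ii) for each $i\in I$, there exist $j\in \left(i\chi^{(f)}\right)\gamma^{-1}$ and $k\in (i\gamma)\left(\chi^{(f)}\right)^{-1}$ such that $\pi_{X_i}(f)\varphi\subseteq \pi_{X_j}(g)$ and $\pi_{X_i}(g)\varphi^{-1}\subseteq \pi_{X_k}(f)$.
   Context: $X$ is a nonempty set (possibly infinite) and $\mathcal{P}=\{X_i : i\in I\}$ is a partition of $X$ into nonempty blocks, with $X_i\cap X_j=\varnothing$ for $i\neq j$. $T(Z)$ denotes the semigroup of all maps $Z\to Z$ under composition. Maps are written on the right and composed from left to right: $x(fg)=(xf)g$; $Af=\{af: a\in A\}$; for a map $\delta\in T(I)$ and $m\in I$, $m\delta^{-1}=\{l\in I: l\delta=m\}$. $T(X,\mathcal{P})$ is the subsemigroup (containing $\mathrm{id}_X$) of all $f\in T(X)$ such that for every $i\in I$ there is $j\in I$ with $X_if\subseteq X_j$. For $f\in T(X,\mathcal{P})$ the character $\chi^{(f)}\in T(I)$ is defined by $i\chi^{(f)}=j$ whenever $X_if\subseteq X_j$. In a semigroup $S$ with identity, Green's relations are: $(a,b)\in\mathcal{L}$ iff $Sa=Sb$; $(a,b)\in\mathcal{R}$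 iff $aS=bS$; and $\mathcal{D}=\mathcal{L}\circ\mathcal{R}=\mathcal{R}\circ\mathcal{L}$. For $f\in T(X)$, $\pi(f)$ is the partition of $X$ into the classes of $\ker(f)=\{(a,b)\in X\times X: af=bf\}$, and for $A\subseteq X$, $\pi_A(f)=\{M\in\pi(f): M\cap A\neq\varnothing\}$. *)

theory Defs
  imports "HOL-Algebra.Coset" "HOL-Library.Disjoint_Sets"
begin

(* Maps Z -> Z are represented by extensional functions, so that two maps agreeing on Z are equal.
   Maps act on the right and compose from left to right, i.e. x(fg) = (xf)g; hence the product of
   f and g applies f first. *)
definition full_transf :: "'a set \<Rightarrow> ('a \<Rightarrow> 'a) monoid" where
  "full_transf Z =
     \<lparr>carrier = Z \<rightarrow>\<^sub>E Z, mult = (\<lambda>f g. compose Z g f), one = (\<lambda>x\<in>Z. x)\<rparr>"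

definition block_transf :: "'a set \<Rightarrow> 'i set \<Rightarrow> ('i \<Rightarrow> 'a set) \<Rightarrow> ('a \<Rightarrow> 'a) monoid" where
  "block_transf X I B =
     (full_transf X)
       \<lparr>carrier := {f \<in> carrier (full_transf X). \<forall>i\<in>I. \<exists>j\<in>I. f ` B i \<subseteq> B j}\<rparr>"

definition character :: "'i set \<Rightarrow> ('i \<Rightarrow> 'a set) \<Rightarrow> ('a \<Rightarrow> 'a) \<Rightarrow> 'i \<Rightarrow> 'i" where
  "character I B f = (\<lambda>i\<in>I. THE j. j \<in> I \<and> f ` B i \<subseteq> B j)"

(* In the notation of HOL-Algebra, carrier S #> a is Sa and a <# carrier S is aS. *)
definition green_L :: "('a, 'b) monoid_scheme \<Rightarrow> 'a rel" where
  "green_L S = {(a, b) \<in> carrier S \<times> carrier S. carrier S #>\<^bsub>S\<^esub> a = carrier S #>\<^bsub>S\<^esub> b}"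

definition green_R :: "('a, 'b) monoid_scheme \<Rightarrow> 'a rel" where
  "green_R S = {(a, b) \<in> carrier S \<times> carrier S. a <#\<^bsub>S\<^esub> carrier S = b <#\<^bsub>S\<^esub> carrier S}"

definition green_D :: "('a, 'b) monoid_scheme \<Rightarrow> 'a rel" where
  "green_D S = green_L S O green_R S"

definition map_ker :: "'a set \<Rightarrow> ('a \<Rightarrow> 'a) \<Rightarrow> 'a rel" where
  "map_ker X f = {(a, b) \<in> X \<times> X. f a = f b}"

definition ker_classes :: "'a set \<Rightarrow> ('a \<Rightarrow> 'a) \<Rightarrow> 'a set set" where
  "ker_classes X f = X // map_ker X f"

definition ker_classes_meeting :: "'a set \<Rightarrow> 'a set \<Rightarrow> ('a \<Rightarrow> 'a) \<Rightarrow> 'a set set" where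
  "ker_classes_meeting X A f = {M \<in> ker_classes X f. M \<inter> A \<noteq> {}}"

lemma monoid_full_transf: "monoid (full_transf Z)"
proof (rule monoidI)
  fix f g h
  assume "f \<in> carrier (full_transf Z)" "g \<in> carrier (full_transf Z)"
    "h \<in> carrier (full_transf Z)"
  then have "f \<in> Z \<rightarrow> Z" by (auto simp: full_transf_def)
  then show "f \<otimes>\<^bsub>full_transf Z\<^esub> g \<otimes>\<^bsub>full_transf Z\<^esub> h =
      f \<otimes>\<^bsub>full_transf Z\<^esub> (g \<otimes>\<^bsub>full_transf Z\<^esub> h)"
    by (simp add: full_transf_def compose_assoc[of f Z Z])
next
  fix f g
  assume "f \<in> carrier (full_transf Z)" "g \<in> carrier (full_transf Z)"
  then show "f \<otimes>\<^bsub>full_transf Z\<^esub> g \<in> carrier (full_transf Z)"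
    by (auto simp: full_transf_def compose_def)
next
  show "\<one>\<^bsub>full_transf Z\<^esub> \<in> carrier (full_transf Z)"
    by (simp add: full_transf_def)
next
  fix f
  assume "f \<in> carrier (full_transf Z)"
  then have f: "f \<in> Z \<rightarrow> Z" "f \<in> extensional Z"
    by (simp_all add: full_transf_def PiE_def)
  show "\<one>\<^bsub>full_transf Z\<^esub> \<otimes>\<^bsub>full_transf Z\<^esub> f = f"
    using compose_Id[OF f] by (simp add: full_transf_def)
  show "f \<otimes>\<^bsub>full_transf Z\<^esub> \<one>\<^bsub>full_transf Z\<^esub> = f"
    using Id_compose[OF f] by (simp add: full_transf_def)
qed

lemma monoid_block_transf:
  assumes "partition_on X (B ` I)"
  shows "monoid (block_transf X I B)"
proof -
  have sub: "B i \<subseteq> X" if "i \<in> I" for i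
    using partition_onD1[OF assms] that by auto
  have closed: "\<exists>k\<in>I. compose X g f ` B i \<subseteq> B k"
    if i: "i \<in> I" and f: "\<forall>i\<in>I. \<exists>j\<in>I. f ` B i \<subseteq> B j"
      and g: "\<forall>i\<in>I. \<exists>j\<in>I. g ` B i \<subseteq> B j" for f g i
  proof -
    obtain j where j: "j \<in> I" "f ` B i \<subseteq> B j" using i f by blast
    obtain k where k: "k \<in> I" "g ` B j \<subseteq> B k" using g j by blast
    have "compose X g f ` B i = g ` f ` B i"
      using sub[OF i] by (auto simp: compose_def image_image cong: image_cong_simp)
    with j k show ?thesis by blast
  qed
  have one: "\<exists>j\<in>I. (\<lambda>x\<in>X. x) ` B i \<subseteq> B j" if "i \<in> I" for i
    using that sub[OF that] by (intro bexI[of _ i]) auto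
  interpret T: monoid "full_transf X"
    by (rule monoid_full_transf)
  show ?thesis
  proof (rule monoidI)
    fix f g
    assume fg: "f \<in> carrier (block_transf X I B)" "g \<in> carrier (block_transf X I B)"
    then have "f \<otimes>\<^bsub>full_transf X\<^esub> g \<in> carrier (full_transf X)"
      by (simp add: block_transf_def)
    moreover have "\<forall>i\<in>I. \<exists>k\<in>I. compose X g f ` B i \<subseteq> B k"
      using fg closed[of _ f g] by (simp add: block_transf_def)
    ultimately show "f \<otimes>\<^bsub>block_transf X I B\<^esub> g \<in> carrier (block_transf X I B)"
      by (simp add: block_transf_def full_transf_def)
  next
    show "\<one>\<^bsub>block_transf X I B\<^esub> \<in> carrier (block_transf X I B)"
      using T.one_closed one by (simp add: block_transf_def full_transf_def)
  next
    show "\<one>\<^bsub>block_transf X I B\<^esub> \<otimes>\<^bsub>block_transf X I B\<^esub> f = f"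
      if "f \<in> carrier (block_transf X I B)" for f
      using that T.l_one[of f] by (simp add: block_transf_def)
    show "f \<otimes>\<^bsub>block_transf X I B\<^esub> \<one>\<^bsub>block_transf X I B\<^esub> = f"
      if "f \<in> carrier (block_transf X I B)" for f
      using that T.r_one[of f] by (simp add: block_transf_def)
    show "f \<otimes>\<^bsub>block_transf X I B\<^esub> g \<otimes>\<^bsub>block_transf X I B\<^esub> h =
        f \<otimes>\<^bsub>block_transf X I B\<^esub> (g \<otimes>\<^bsub>block_transf X I B\<^esub> h)"
      if "f \<in> carrier (block_transf X I B)" "g \<in> carrier (block_transf X I B)"
        "h \<in> carrier (block_transf X I B)" for f g h
      using that T.m_assoc[of f g h] by (simp add: block_transf_def)
  qed
qed

lemma character_eqI:
  assumes "partition_on X (B ` I)" "disjoint_family_on B I"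
    and "i \<in> I" "j \<in> I" "f ` B i \<subseteq> B j"
  shows "character I B f i = j"
proof -
  have ne: "f ` B i \<noteq> {}"
    using assms(1,3) by (auto simp: partition_on_def)
  have "k = j" if "k \<in> I" "f ` B i \<subseteq> B k" for k
    using ne that assms(2,4,5) unfolding disjoint_family_on_def by blast
  then have "(THE j. j \<in> I \<and> f ` B i \<subseteq> B j) = j"
    using assms(4,5) by (intro the_equality) blast+
  then show ?thesis
    using assms(3) by (simp add: character_def)
qed

end

theory Submission imports Defs begin

text \<open>
  In a transformation monoid acting on the right, multiplying on the left selects image points and
  multiplying on the right merges kernel classes. For maps that respect a partition this becomes:
  \<open>f\<close> is a left multiple of \<open>h\<close> iff the image of every block under \<open>f\<close> lies in the image of some
  block under \<open>h\<close> (\<open>left_multiple_iff\<close>), and \<open>f\<close> is a right multiple of \<open>h\<close> iff \<open>f\<close> merges all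
  points merged by \<open>h\<close> and the character of \<open>f\<close> merges all indices merged by the character of \<open>h\<close>
  (\<open>right_multiple_iff\<close>).

  Now \<open>(f, g) \<in> \<D>\<close> means that some \<open>h\<close> satisfies \<open>f \<L> h \<R> g\<close>. The pair \<open>(\<gamma>, \<phi>)\<close> of the theorem
  encodes such an \<open>h\<close>. The map \<open>\<gamma>\<close> is the character of \<open>h\<close>. Since \<open>f\<close> and \<open>h\<close> have the same image
  and \<open>h\<close> and \<open>g\<close> have the same kernel, sending the fibre of \<open>f\<close> over \<open>v\<close> to the fibre of \<open>h\<close> over
  \<open>v\<close> is a bijection \<open>\<phi>\<close> from the kernel classes of \<open>f\<close> to those of \<open>g\<close>. Conversely, \<open>\<phi>\<close> determines
  \<open>h\<close>: a point in the kernel class \<open>N\<close> of \<open>g\<close> goes to the value of \<open>f\<close> on the class that \<open>\<phi>\<close> sends to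
  \<open>N\<close>. The kernel classes meeting a block are exactly the fibres over the image of that block, so
  the inclusions between classes meeting blocks say that images of blocks under \<open>f\<close> and under \<open>h\<close>
  are contained in one another; this is the criterion for \<open>f \<L> h\<close>.
\<close>

section \<open>Green's relations by divisibility\<close>

lemma (in monoid) green_L_iff:
  "(a, b) \<in> green_L G \<longleftrightarrow> a \<in> carrier G \<and> b \<in> carrier G \<and>
     (\<exists>u\<in>carrier G. a = u \<otimes> b) \<and> (\<exists>v\<in>carrier G. b = v \<otimes> a)"
proof -
  have sub: "carrier G #> x \<subseteq> carrier G #> y \<longleftrightarrow> (\<exists>u\<in>carrier G. x = u \<otimes> y)"
    if x: "x \<in> carrier G" and y: "y \<in> carrier G" for x y
  proof
    assume "carrier G #> x \<subseteq> carrier G #> y"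
    moreover have "\<one> \<otimes> x \<in> carrier G #> x"
      unfolding r_coset_def by blast
    ultimately show "\<exists>u\<in>carrier G. x = u \<otimes> y"
      using x by (auto simp: r_coset_def)
  next
    assume "\<exists>u\<in>carrier G. x = u \<otimes> y"
    then obtain u where u: "u \<in> carrier G" "x = u \<otimes> y" by blast
    have "w \<otimes> x \<in> carrier G #> y" if "w \<in> carrier G" for w
      using that u y m_assoc[of w u y, symmetric] by (auto simp: r_coset_def intro: m_closed)
    then show "carrier G #> x \<subseteq> carrier G #> y"
      by (auto simp: r_coset_def)
  qed
  show ?thesis
    using sub[of a b] sub[of b a] unfolding green_L_def by auto
qed

lemma (in monoid) green_R_iff:
  "(a, b) \<in> green_R G \<longleftrightarrow> a \<in> carrier G \<and> b \<in> carrier G \<and>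
     (\<exists>u\<in>carrier G. a = b \<otimes> u) \<and> (\<exists>v\<in>carrier G. b = a \<otimes> v)"
proof -
  have sub: "x <# carrier G \<subseteq> y <# carrier G \<longleftrightarrow> (\<exists>u\<in>carrier G. x = y \<otimes> u)"
    if x: "x \<in> carrier G" and y: "y \<in> carrier G" for x y
  proof
    assume "x <# carrier G \<subseteq> y <# carrier G"
    moreover have "x \<otimes> \<one> \<in> x <# carrier G"
      unfolding l_coset_def by blast
    ultimately show "\<exists>u\<in>carrier G. x = y \<otimes> u"
      using x by (auto simp: l_coset_def)
  next
    assume "\<exists>u\<in>carrier G. x = y \<otimes> u"
    then obtain u where u: "u \<in> carrier G" "x = y \<otimes> u" by blast
    have "x \<otimes> w \<in> y <# carrier G" if "w \<in> carrier G" for w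
      using that u y m_assoc[of y u w] by (auto simp: l_coset_def intro: m_closed)
    then show "x <# carrier G \<subseteq> y <# carrier G"
      by (auto simp: l_coset_def)
  qed
  show ?thesis
    using sub[of a b] sub[of b a] unfolding green_R_def by auto
qed

lemma full_transf_green_R_imp_same_kernel:
  assumes "(a, b) \<in> green_R (full_transf Z)" "x \<in> Z" "y \<in> Z"
  shows "a x = a y \<longleftrightarrow> b x = b y"
proof -
  obtain u v where "a = compose Z u b" "b = compose Z v a"
    using assms(1) unfolding monoid.green_R_iff[OF monoid_full_transf]
    by (auto simp: full_transf_def)
  then show ?thesis
    using assms(2,3) by (metis compose_eq)
qed

section \<open>Kernel classes as fibres\<close>

definition fibre :: "'a set \<Rightarrow> ('a \<Rightarrow> 'b) \<Rightarrow> 'b \<Rightarrow> 'a set" where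
  "fibre X f v = {x \<in> X. f x = v}"

lemma ker_classes_eq_fibres: "ker_classes X f = fibre X f ` f ` X"
proof -
  have "map_ker X f `` {x} = fibre X f (f x)" if "x \<in> X" for x
    using that by (auto simp: map_ker_def fibre_def)
  then show ?thesis
    unfolding ker_classes_def quotient_def image_image by auto
qed

lemma ker_classes_meeting_eq_fibres:
  assumes "A \<subseteq> X"
  shows "ker_classes_meeting X A f = fibre X f ` f ` A"
proof -
  have "fibre X f v \<inter> A \<noteq> {} \<longleftrightarrow> v \<in> f ` A" for v
    using assms by (auto simp: fibre_def)
  then show ?thesis
    using assms unfolding ker_classes_meeting_def ker_classes_eq_fibres by blast
qed

lemma inj_on_fibre: "inj_on (fibre X f) (f ` X)"
  by (fastforce simp: inj_on_def fibre_def)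

lemma bij_betw_fibre: "bij_betw (fibre X f) (f ` X) (ker_classes X f)"
  by (simp add: bij_betw_def inj_on_fibre ker_classes_eq_fibres)

text \<open>
  Maps with a common image are matched fibre by fibre; in this matching, passing between kernel
  classes met by two sets amounts to comparing images of these sets.
\<close>

lemma fibre_matching:
  assumes "f ` X = h ` X"
  obtains \<phi> where "bij_betw \<phi> (ker_classes X f) (ker_classes X h)"
    and "\<And>A. A \<subseteq> X \<Longrightarrow> \<phi> ` ker_classes_meeting X A f = fibre X h ` f ` A"
    and "\<And>A. A \<subseteq> X \<Longrightarrow>
      inv_into (ker_classes X f) \<phi> ` ker_classes_meeting X A h = fibre X f ` h ` A"
proof -
  define \<phi> where "\<phi> = fibre X h \<circ> inv_into (f ` X) (fibre X f)"
  have bij: "bij_betw \<phi> (ker_classes X f) (ker_classes X h)"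
    unfolding \<phi>_def
    using bij_betw_trans[OF bij_betw_inv_into[OF bij_betw_fibre[of X f]]] bij_betw_fibre[of X h] assms
    by simp
  have \<phi>: "\<phi> (fibre X f v) = fibre X h v" if "v \<in> f ` X" for v
    using that by (simp add: \<phi>_def inv_into_f_f[OF inj_on_fibre])
  have inv: "inv_into (ker_classes X f) \<phi> (fibre X h v) = fibre X f v" if "v \<in> f ` X" for v
    using bij_betw_inv_into_left[OF bij, of "fibre X f v"] that \<phi>[OF that]
    by (simp add: ker_classes_eq_fibres)
  show ?thesis
  proof
    show "bij_betw \<phi> (ker_classes X f) (ker_classes X h)" by (fact bij)
  next
    fix A assume A: "A \<subseteq> X"
    have "v \<in> f ` X" if "v \<in> f ` A" for v
      using that A by blast
    then show "\<phi> ` ker_classes_meeting X A f = fibre X h ` f ` A"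
      unfolding ker_classes_meeting_eq_fibres[OF A] image_image[of _ _ "f ` A"]
      by (intro image_cong refl \<phi>)
    have "v \<in> f ` X" if "v \<in> h ` A" for v
      using that A assms by blast
    then show "inv_into (ker_classes X f) \<phi> ` ker_classes_meeting X A h = fibre X f ` h ` A"
      unfolding ker_classes_meeting_eq_fibres[OF A] image_image[of _ _ "h ` A"]
      by (intro image_cong refl inv)
  qed
qed

text \<open>
  Conversely, a bijection between kernel classes transports the values of \<open>f\<close> to the fibres of
  \<open>g\<close>, giving a map with the kernel of \<open>g\<close>.
\<close>

lemma transport_along_class_bijection:
  assumes bij: "bij_betw \<phi> (ker_classes X f) (ker_classes X g)"
  obtains h where "h \<in> extensional X"
    and "h ` X \<subseteq> f ` X"
    and "\<And>x y. x \<in> X \<Longrightarrow> y \<in> X \<Longrightarrow> h x = h y \<longleftrightarrow> g x = g y"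
    and "\<And>A C. A \<subseteq> X \<Longrightarrow> C \<subseteq> X \<Longrightarrow>
      \<phi> ` ker_classes_meeting X A f \<subseteq> ker_classes_meeting X C g \<Longrightarrow> f ` A \<subseteq> h ` C"
    and "\<And>A C. A \<subseteq> X \<Longrightarrow> C \<subseteq> X \<Longrightarrow>
      inv_into (ker_classes X f) \<phi> ` ker_classes_meeting X A g \<subseteq> ker_classes_meeting X C f
      \<Longrightarrow> h ` A \<subseteq> f ` C"
proof -
  define \<psi> where "\<psi> = inv_into (ker_classes X f) \<phi>"
  define val where "val = inv_into (f ` X) (fibre X f)"
  define h where "h = (\<lambda>x\<in>X. val (\<psi> (fibre X g (g x))))"
  have val: "val (fibre X f v) = v" if "v \<in> f ` X" for v
    using that by (simp add: val_def inv_into_f_f[OF inj_on_fibre])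
  have "bij_betw (val \<circ> (\<psi> \<circ> fibre X g)) (g ` X) (f ` X)"
    unfolding val_def \<psi>_def
    using bij_betw_trans[OF bij_betw_trans[OF bij_betw_fibre bij_betw_inv_into[OF bij]]
      bij_betw_inv_into[OF bij_betw_fibre]]
    by (simp add: comp_assoc)
  then have bij': "bij_betw (\<lambda>v. val (\<psi> (fibre X g v))) (g ` X) (f ` X)"
    by (simp add: comp_def)
  have h_image: "h ` A = val ` \<psi> ` ker_classes_meeting X A g" if "A \<subseteq> X" for A
    using that unfolding ker_classes_meeting_eq_fibres[OF that] image_image h_def
    by (intro image_cong) auto
  have f_image: "f ` A = val ` ker_classes_meeting X A f" if "A \<subseteq> X" for A
  proof -
    have "val ` fibre X f ` f ` A = (\<lambda>v. v) ` f ` A"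
      unfolding image_image[of val] using that by (intro image_cong refl val) auto
    then show ?thesis
      by (simp add: ker_classes_meeting_eq_fibres[OF that])
  qed
  show ?thesis
  proof
    show "h \<in> extensional X"
      by (simp add: h_def)
    show "h ` X \<subseteq> f ` X"
      using bij_betw_apply[OF bij'] by (auto simp: h_def)
    show "h x = h y \<longleftrightarrow> g x = g y" if "x \<in> X" "y \<in> X" for x y
      using that inj_on_eq_iff[OF bij_betw_imp_inj_on[OF bij'], of "g x" "g y"]
      by (simp add: h_def)
  next
    fix A C assume AC: "A \<subseteq> X" "C \<subseteq> X"
      and sub: "\<phi> ` ker_classes_meeting X A f \<subseteq> ker_classes_meeting X C g"
    have "M \<in> \<psi> ` ker_classes_meeting X C g" if M: "M \<in> ker_classes_meeting X A f" for M
    proof -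
      have "M \<in> ker_classes X f"
        using M by (simp add: ker_classes_meeting_def)
      then have "M = \<psi> (\<phi> M)"
        using bij_betw_inv_into_left[OF bij] by (simp add: \<psi>_def)
      then show ?thesis
        using sub M by blast
    qed
    then show "f ` A \<subseteq> h ` C"
      unfolding f_image[OF AC(1)] h_image[OF AC(2)] by (intro image_mono subsetI)
  next
    fix A C assume AC: "A \<subseteq> X" "C \<subseteq> X"
      and "inv_into (ker_classes X f) \<phi> ` ker_classes_meeting X A g \<subseteq> ker_classes_meeting X C f"
    then show "h ` A \<subseteq> f ` C"
      unfolding f_image[OF AC(2)] h_image[OF AC(1)] by (intro image_mono) (simp add: \<psi>_def)
  qed
qed

section \<open>Divisibility in the monoid of block-respecting maps\<close>

locale labelled_partition =
  fixes X :: "'a set" and I :: "'i set" and B :: "'i \<Rightarrow> 'a set"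
  assumes partition: "partition_on X (B ` I)"
    and disjoint: "disjoint_family_on B I"
begin

abbreviation S where "S \<equiv> block_transf X I B"
abbreviation \<chi> where "\<chi> \<equiv> character I B"

lemma block_subset: "i \<in> I \<Longrightarrow> B i \<subseteq> X"
  using partition_onD1[OF partition] by blast

lemma block_nonempty: "i \<in> I \<Longrightarrow> B i \<noteq> {}"
  using partition by (auto simp: partition_on_def)

lemma block_unique: "i \<in> I \<Longrightarrow> j \<in> I \<Longrightarrow> x \<in> B i \<Longrightarrow> x \<in> B j \<Longrightarrow> i = j"
  using disjoint unfolding disjoint_family_on_def by blast

lemma in_block: "x \<in> X \<Longrightarrow> \<exists>i\<in>I. x \<in> B i"
  using partition_onD1[OF partition] by blast

lemma mult_S: "f \<otimes>\<^bsub>S\<^esub> g = compose X g f"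
  by (simp add: block_transf_def full_transf_def)

lemma carrier_S: "f \<in> carrier S \<longleftrightarrow> f \<in> X \<rightarrow>\<^sub>E X \<and> (\<forall>i\<in>I. \<exists>j\<in>I. f ` B i \<subseteq> B j)"
  by (simp add: block_transf_def full_transf_def)

lemma character_eq: "i \<in> I \<Longrightarrow> j \<in> I \<Longrightarrow> f ` B i \<subseteq> B j \<Longrightarrow> \<chi> f i = j"
  by (rule character_eqI[OF partition disjoint])

lemma image_block: "f \<in> carrier S \<Longrightarrow> i \<in> I \<Longrightarrow> f ` B i \<subseteq> B (\<chi> f i)"
  and character_in: "f \<in> carrier S \<Longrightarrow> i \<in> I \<Longrightarrow> \<chi> f i \<in> I"
  using character_eq carrier_S by metis+

lemma character_carrier: "f \<in> carrier S \<Longrightarrow> \<chi> f \<in> carrier (full_transf I)"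
  using character_in by (auto simp: full_transf_def character_def)

lemma character_mult:
  assumes "f \<in> carrier S" "g \<in> carrier S"
  shows "\<chi> (f \<otimes>\<^bsub>S\<^esub> g) = \<chi> f \<otimes>\<^bsub>full_transf I\<^esub> \<chi> g"
proof
  fix i
  show "\<chi> (f \<otimes>\<^bsub>S\<^esub> g) i = (\<chi> f \<otimes>\<^bsub>full_transf I\<^esub> \<chi> g) i"
  proof (cases "i \<in> I")
    case True
    have "(f \<otimes>\<^bsub>S\<^esub> g) ` B i = g ` f ` B i"
      using block_subset[OF True] by (force simp: mult_S compose_def)
    also have "\<dots> \<subseteq> B (\<chi> g (\<chi> f i))"
      using image_mono[OF image_block[OF assms(1) True]]
        image_block[OF assms(2) character_in[OF assms(1) True]] by (rule subset_trans)
    finally show ?thesis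
      using True assms character_in
      by (simp add: full_transf_def compose_eq character_eq)
  qed (simp add: character_def full_transf_def compose_def)
qed

text \<open>
  Taking characters is a homomorphism of monoids, hence it preserves Green's relations.
\<close>

lemma character_green_L:
  assumes "(f, h) \<in> green_L S"
  shows "(\<chi> f, \<chi> h) \<in> green_L (full_transf I)"
  using assms character_mult character_carrier
  unfolding monoid.green_L_iff[OF monoid_full_transf]
    monoid.green_L_iff[OF monoid_block_transf[OF partition]]
  by metis

lemma character_green_R:
  assumes "(f, h) \<in> green_R S"
  shows "(\<chi> f, \<chi> h) \<in> green_R (full_transf I)"
  using assms character_mult character_carrier
  unfolding monoid.green_R_iff[OF monoid_full_transf]
    monoid.green_R_iff[OF monoid_block_transf[OF partition]]
  by metis

text \<open>
  A left factor picks for each point a preimage under \<open>h\<close> of its value under \<open>f\<close>. It respects the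
  partition exactly when the preimages for the points of one block can be picked in one block.
\<close>

lemma left_multiple_iff:
  assumes f: "f \<in> carrier S" and h: "h \<in> carrier S"
  shows "(\<exists>a\<in>carrier S. f = a \<otimes>\<^bsub>S\<^esub> h) \<longleftrightarrow> (\<forall>i\<in>I. \<exists>j\<in>I. f ` B i \<subseteq> h ` B j)"
    (is "?div \<longleftrightarrow> ?img")
proof
  assume ?div
  then obtain a where a: "a \<in> carrier S" and fa: "f = compose X h a"
    by (auto simp: mult_S)
  show ?img
  proof
    fix i assume i: "i \<in> I"
    have "f ` B i \<subseteq> h ` B (\<chi> a i)"
      using image_block[OF a i] by (auto simp: fa compose_eq[OF subsetD[OF block_subset[OF i]]])
    then show "\<exists>j\<in>I. f ` B i \<subseteq> h ` B j"
      using character_in[OF a i] by blast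
  qed
next
  assume ?img
  then obtain \<beta> where \<beta>: "\<And>i. i \<in> I \<Longrightarrow> \<beta> i \<in> I" "\<And>i. i \<in> I \<Longrightarrow> f ` B i \<subseteq> h ` B (\<beta> i)"
    by metis
  have "\<exists>y. \<forall>i\<in>I. x \<in> B i \<longrightarrow> y \<in> B (\<beta> i) \<and> h y = f x" if x: "x \<in> X" for x
  proof -
    obtain i where i: "i \<in> I" "x \<in> B i" using in_block[OF x] by blast
    then obtain y where "y \<in> B (\<beta> i)" "h y = f x"
      using \<beta>(2)[OF i(1)] by (metis image_iff image_subset_iff)
    then show ?thesis using i block_unique by blast
  qed
  then obtain p where p: "\<And>x i. x \<in> X \<Longrightarrow> i \<in> I \<Longrightarrow> x \<in> B i \<Longrightarrow> p x \<in> B (\<beta> i) \<and> h (p x) = f x"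
    by metis
  define a where "a = restrict p X"
  have ai: "a ` B i \<subseteq> B (\<beta> i)" if "i \<in> I" for i
    using p that block_subset[OF that] by (auto simp: a_def)
  have "a x \<in> X" if "x \<in> X" for x
    using in_block[OF that] ai \<beta>(1) block_subset by blast
  then have "a \<in> carrier S"
    unfolding carrier_S using ai \<beta>(1) by (metis PiE_I a_def restrict_apply)
  moreover have "f = a \<otimes>\<^bsub>S\<^esub> h"
  proof (rule extensionalityI[where A = X])
    show "f \<in> extensional X" using f by (auto simp: carrier_S PiE_iff)
    show "f x = (a \<otimes>\<^bsub>S\<^esub> h) x" if "x \<in> X" for x
      using in_block[OF that] p[OF that] that by (auto simp: mult_S compose_eq a_def)
  qed (simp add: mult_S)
  ultimately show ?div by blast
qed

text \<open>
  The kernel condition determines the right factor on the image of \<open>h\<close>. The condition on characters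
  says that the image points inside one block go to one block, and the remaining points of
  that block can then be sent anywhere in that target block.
\<close>

lemma right_multiple_iff:
  assumes f: "f \<in> carrier S" and h: "h \<in> carrier S"
  shows "(\<exists>a\<in>carrier S. f = h \<otimes>\<^bsub>S\<^esub> a) \<longleftrightarrow>
    (\<forall>x\<in>X. \<forall>y\<in>X. h x = h y \<longrightarrow> f x = f y) \<and>
    (\<forall>i\<in>I. \<forall>j\<in>I. \<chi> h i = \<chi> h j \<longrightarrow> \<chi> f i = \<chi> f j)"
    (is "?div \<longleftrightarrow> ?ker \<and> ?char")
proof
  assume ?div
  then obtain a where a: "a \<in> carrier S" and fa: "f = h \<otimes>\<^bsub>S\<^esub> a" by blast
  have ?ker
    by (simp add: fa mult_S compose_eq)
  moreover have ?char
    unfolding fa character_mult[OF h a] by (simp add: full_transf_def compose_eq)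
  ultimately show "?ker \<and> ?char" ..
next
  assume "?ker \<and> ?char"
  then have ker: "\<And>x y. x \<in> X \<Longrightarrow> y \<in> X \<Longrightarrow> h x = h y \<Longrightarrow> f x = f y"
    and char: "\<And>i j. i \<in> I \<Longrightarrow> j \<in> I \<Longrightarrow> \<chi> h i = \<chi> h j \<Longrightarrow> \<chi> f i = \<chi> f j"
    by blast+
  \<comment> \<open>The character of the right factor. Blocks whose index is not a value of the character of
    \<open>h\<close> do not meet the image of \<open>h\<close>, so mapping them into themselves is harmless.\<close>
  define \<alpha> where "\<alpha> m = (if m \<in> \<chi> h ` I then \<chi> f (inv_into I (\<chi> h) m) else m)" for m
  have \<alpha>_in: "\<alpha> m \<in> I" if "m \<in> I" for m
    using that character_in[OF f] by (auto simp: \<alpha>_def inv_into_into)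
  have \<alpha>: "\<alpha> (\<chi> h i) = \<chi> f i" if "i \<in> I" for i
    using that char[of "inv_into I (\<chi> h) (\<chi> h i)" i]
    by (auto simp: \<alpha>_def inv_into_into f_inv_into_f)
  have "\<exists>z. (\<forall>m\<in>I. y \<in> B m \<longrightarrow> z \<in> B (\<alpha> m)) \<and> (\<forall>x\<in>X. h x = y \<longrightarrow> z = f x)"
    if y: "y \<in> X" for y
  proof (cases "y \<in> h ` X")
    case True
    then obtain x where x: "x \<in> X" "h x = y" by blast
    obtain i where i: "i \<in> I" "x \<in> B i" using in_block[OF x(1)] by blast
    have "y \<in> B (\<chi> h i)" "f x \<in> B (\<alpha> (\<chi> h i))"
      using image_block[OF h i(1)] image_block[OF f i(1)] i x \<alpha>[OF i(1)] by auto
    then have "\<forall>m\<in>I. y \<in> B m \<longrightarrow> f x \<in> B (\<alpha> m)"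
      using block_unique character_in[OF h i(1)] by blast
    moreover have "\<forall>x'\<in>X. h x' = y \<longrightarrow> f x = f x'"
      using ker x by metis
    ultimately show ?thesis by blast
  next
    case False
    obtain m where m: "m \<in> I" "y \<in> B m" using in_block[OF y] by blast
    obtain z where "z \<in> B (\<alpha> m)" using block_nonempty[OF \<alpha>_in[OF m(1)]] by blast
    then show ?thesis using False m block_unique by blast
  qed
  then obtain q where q: "\<And>y m. y \<in> X \<Longrightarrow> m \<in> I \<Longrightarrow> y \<in> B m \<Longrightarrow> q y \<in> B (\<alpha> m)"
    "\<And>y x. y \<in> X \<Longrightarrow> x \<in> X \<Longrightarrow> h x = y \<Longrightarrow> q y = f x"
    by metis
  define a where "a = restrict q X"
  have am: "a ` B m \<subseteq> B (\<alpha> m)" if "m \<in> I" for m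
    using q(1) that block_subset[OF that] by (auto simp: a_def)
  have "a x \<in> X" if "x \<in> X" for x
    using in_block[OF that] am \<alpha>_in block_subset by blast
  then have "a \<in> carrier S"
    unfolding carrier_S using am \<alpha>_in by (metis PiE_I a_def restrict_apply)
  moreover have "f = h \<otimes>\<^bsub>S\<^esub> a"
  proof (rule extensionalityI[where A = X])
    show "f \<in> extensional X" using f by (auto simp: carrier_S PiE_iff)
    show "f x = (h \<otimes>\<^bsub>S\<^esub> a) x" if "x \<in> X" for x
      using that h q(2)[of "h x" x] by (auto simp: mult_S compose_eq a_def carrier_S)
  qed (simp add: mult_S)
  ultimately show ?div by blast
qed

lemma green_L_block_iff:
  "(f, h) \<in> green_L S \<longleftrightarrow> f \<in> carrier S \<and> h \<in> carrier S \<and>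
    (\<forall>i\<in>I. \<exists>j\<in>I. f ` B i \<subseteq> h ` B j) \<and> (\<forall>i\<in>I. \<exists>k\<in>I. h ` B i \<subseteq> f ` B k)"
  unfolding monoid.green_L_iff[OF monoid_block_transf[OF partition]]
  using left_multiple_iff[of f h] left_multiple_iff[of h f] by blast

lemma green_R_block_iff:
  "(h, g) \<in> green_R S \<longleftrightarrow> h \<in> carrier S \<and> g \<in> carrier S \<and>
    (\<forall>x\<in>X. \<forall>y\<in>X. h x = h y \<longleftrightarrow> g x = g y) \<and>
    (\<forall>i\<in>I. \<forall>j\<in>I. \<chi> h i = \<chi> h j \<longleftrightarrow> \<chi> g i = \<chi> g j)"
  unfolding monoid.green_R_iff[OF monoid_block_transf[OF partition]]
  using right_multiple_iff[of g h] right_multiple_iff[of h g] by blast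

lemma image_eq_of_green_L:
  assumes "(f, h) \<in> green_L S"
  shows "f ` X = h ` X"
proof -
  have sub: "f ` X \<subseteq> h ` X" if *: "\<forall>i\<in>I. \<exists>j\<in>I. f ` B i \<subseteq> h ` B j" for f h
  proof (rule image_subsetI)
    fix x assume "x \<in> X"
    then obtain i where i: "i \<in> I" "x \<in> B i" using in_block by blast
    then obtain j where j: "j \<in> I" "f ` B i \<subseteq> h ` B j" using * by blast
    show "f x \<in> h ` X"
      using image_mono[OF block_subset[OF j(1)], of h] j(2) i(2) by blast
  qed
  show ?thesis
    using assms sub[of f h] sub[of h f] unfolding green_L_block_iff by (intro equalityI) simp_all
qed

text \<open>
  If the image of one block contains that of another, both images lie in the same block: this is
  where the index constraints on \<open>j\<close> and \<open>k\<close> come from.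
\<close>

lemma character_eq_of_image_subset:
  assumes f: "f \<in> carrier S" and h: "h \<in> carrier S" and i: "i \<in> I" and j: "j \<in> I"
    and sub: "f ` B i \<subseteq> h ` B j"
  shows "\<chi> h j = \<chi> f i"
  using character_eq[OF i character_in[OF h j], of f] subset_trans[OF sub image_block[OF h j]] by simp

end

section \<open>The relation \<open>\<D>\<close>\<close>

theorem proposition5p10:
  fixes X :: "'a set" and I :: "'i set" and B :: "'i \<Rightarrow> 'a set" and f g :: "'a \<Rightarrow> 'a"
  assumes "X \<noteq> {}"
    and "partition_on X (B ` I)"
    and "disjoint_family_on B I"
    and "f \<in> carrier (block_transf X I B)"
    and "g \<in> carrier (block_transf X I B)"
  shows "(f, g) \<in> green_D (block_transf X I B) \<longleftrightarrow>
    (\<exists>\<gamma> \<in> carrier (full_transf I). \<exists>\<phi>.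
       bij_betw \<phi> (ker_classes X f) (ker_classes X g) \<and>
       (character I B f, \<gamma>) \<in> green_L (full_transf I) \<and>
       (\<gamma>, character I B g) \<in> green_R (full_transf I) \<and>
       (\<forall>i\<in>I.
          \<exists>j \<in> \<gamma> -` {character I B f i} \<inter> I.
          \<exists>k \<in> character I B f -` {\<gamma> i} \<inter> I.
            \<phi> ` ker_classes_meeting X (B i) f \<subseteq> ker_classes_meeting X (B j) g \<and>
            inv_into (ker_classes X f) \<phi> ` ker_classes_meeting X (B i) g
              \<subseteq> ker_classes_meeting X (B k) f))"
    (is "_ \<longleftrightarrow> ?encoded")
proof -
  interpret labelled_partition X I B
    using assms(2,3) by unfold_locales
  note f = assms(4) and g = assms(5)
  show ?thesis
  proof
    assume "(f, g) \<in> green_D S"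
    then obtain h where L: "(f, h) \<in> green_L S" and R: "(h, g) \<in> green_R S"
      unfolding green_D_def by blast
    have h: "h \<in> carrier S"
      using L by (simp add: green_L_block_iff)
    have "map_ker X h = map_ker X g"
      using R unfolding green_R_block_iff map_ker_def by blast
    then have classes: "ker_classes X h = ker_classes X g"
      "ker_classes_meeting X A h = ker_classes_meeting X A g" for A
      by (simp_all add: ker_classes_def ker_classes_meeting_def)
    obtain \<phi> where \<phi>: "bij_betw \<phi> (ker_classes X f) (ker_classes X h)"
      "\<And>A. A \<subseteq> X \<Longrightarrow> \<phi> ` ker_classes_meeting X A f = fibre X h ` f ` A"
      "\<And>A. A \<subseteq> X \<Longrightarrow>
        inv_into (ker_classes X f) \<phi> ` ker_classes_meeting X A h = fibre X f ` h ` A"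
      by (rule fibre_matching[OF image_eq_of_green_L[OF L]]) (rule that)
    have blocks: "\<exists>j \<in> \<chi> h -` {\<chi> f i} \<inter> I. \<exists>k \<in> \<chi> f -` {\<chi> h i} \<inter> I.
        \<phi> ` ker_classes_meeting X (B i) f \<subseteq> ker_classes_meeting X (B j) g \<and>
        inv_into (ker_classes X f) \<phi> ` ker_classes_meeting X (B i) g
          \<subseteq> ker_classes_meeting X (B k) f" if i: "i \<in> I" for i
    proof -
      obtain j k where j: "j \<in> I" "f ` B i \<subseteq> h ` B j" and k: "k \<in> I" "h ` B i \<subseteq> f ` B k"
        using L i unfolding green_L_block_iff by meson
      have "\<phi> ` ker_classes_meeting X (B i) f \<subseteq> ker_classes_meeting X (B j) g"
        unfolding classes(2)[symmetric] \<phi>(2)[OF block_subset[OF i]]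
          ker_classes_meeting_eq_fibres[OF block_subset[OF j(1)]]
        by (rule image_mono[OF j(2)])
      moreover have "inv_into (ker_classes X f) \<phi> ` ker_classes_meeting X (B i) g
          \<subseteq> ker_classes_meeting X (B k) f"
        unfolding classes(2)[symmetric] \<phi>(3)[OF block_subset[OF i]]
          ker_classes_meeting_eq_fibres[OF block_subset[OF k(1)]]
        by (rule image_mono[OF k(2)])
      ultimately show ?thesis
        using character_eq_of_image_subset[OF f h i j] character_eq_of_image_subset[OF h f i k]
          j(1) k(1) by blast
    qed
    show ?encoded
      by (rule bexI[OF exI[of _ \<phi>] character_carrier[OF h]])
        (use \<phi>(1) classes(1) character_green_L[OF L] character_green_R[OF R] blocks in simp)
  next
    assume ?encoded
    then obtain \<gamma> \<phi> where \<gamma>: "\<gamma> \<in> carrier (full_transf I)"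
      and bij: "bij_betw \<phi> (ker_classes X f) (ker_classes X g)"
      and R\<gamma>: "(\<gamma>, \<chi> g) \<in> green_R (full_transf I)"
      and blocks: "\<forall>i\<in>I. \<exists>j \<in> \<gamma> -` {\<chi> f i} \<inter> I. \<exists>k \<in> \<chi> f -` {\<gamma> i} \<inter> I.
        \<phi> ` ker_classes_meeting X (B i) f \<subseteq> ker_classes_meeting X (B j) g \<and>
        inv_into (ker_classes X f) \<phi> ` ker_classes_meeting X (B i) g
          \<subseteq> ker_classes_meeting X (B k) f"
      by (elim bexE exE conjE) (rule that)
    have to_g: "\<exists>j\<in>I. \<phi> ` ker_classes_meeting X (B i) f \<subseteq> ker_classes_meeting X (B j) g"
      if "i \<in> I" for i
      using bspec[OF blocks that] by (elim bexE conjE) (rule bexI, assumption, blast)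
    have to_f: "\<exists>k\<in>I. \<chi> f k = \<gamma> i \<and>
        inv_into (ker_classes X f) \<phi> ` ker_classes_meeting X (B i) g
          \<subseteq> ker_classes_meeting X (B k) f" if i: "i \<in> I" for i
    proof -
      obtain k where "k \<in> \<chi> f -` {\<gamma> i} \<inter> I"
        "inv_into (ker_classes X f) \<phi> ` ker_classes_meeting X (B i) g
          \<subseteq> ker_classes_meeting X (B k) f"
        using bspec[OF blocks i] by (elim bexE conjE) (rule that)
      then show ?thesis by auto
    qed
    obtain h where ext: "h \<in> extensional X"
      and img: "h ` X \<subseteq> f ` X"
      and ker: "\<And>x y. x \<in> X \<Longrightarrow> y \<in> X \<Longrightarrow> h x = h y \<longleftrightarrow> g x = g y"
      and fh: "\<And>A C. A \<subseteq> X \<Longrightarrow> C \<subseteq> X \<Longrightarrow>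
        \<phi> ` ker_classes_meeting X A f \<subseteq> ker_classes_meeting X C g \<Longrightarrow> f ` A \<subseteq> h ` C"
      and hf: "\<And>A C. A \<subseteq> X \<Longrightarrow> C \<subseteq> X \<Longrightarrow>
        inv_into (ker_classes X f) \<phi> ` ker_classes_meeting X A g \<subseteq> ker_classes_meeting X C f
        \<Longrightarrow> h ` A \<subseteq> f ` C"
      by (rule transport_along_class_bijection[OF bij]) (rule that)
    have f_sub: "\<exists>j\<in>I. f ` B i \<subseteq> h ` B j" if "i \<in> I" for i
      using to_g[OF that] fh block_subset that by meson
    have h_sub: "\<exists>k\<in>I. \<chi> f k = \<gamma> i \<and> h ` B i \<subseteq> f ` B k" if "i \<in> I" for i
      using to_f[OF that] hf block_subset that by meson
    \<comment> \<open>The equation for \<open>k\<close> makes \<open>h\<close> respect the partition with character \<open>\<gamma>\<close>, as \<open>f\<close> maps the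
      block of \<open>k\<close> into that of \<open>\<gamma> i\<close>.\<close>
    have h_block: "h ` B i \<subseteq> B (\<gamma> i)" if "i \<in> I" for i
      using h_sub[OF that] image_block[OF f] by (metis subset_trans)
    have \<gamma>_in: "\<gamma> i \<in> I" if "i \<in> I" for i
      using \<gamma> that by (auto simp: full_transf_def)
    have "f ` X \<subseteq> X"
      using f by (auto simp: carrier_S)
    then have "h x \<in> X" if "x \<in> X" for x
      using img that by blast
    then have h: "h \<in> carrier S"
      unfolding carrier_S using ext h_block \<gamma>_in by (simp add: PiE_iff) blast
    have \<chi>h: "\<chi> h i = \<gamma> i" if "i \<in> I" for i
      using character_eq that \<gamma>_in h_block by blast
    have "(f, h) \<in> green_L S"
      unfolding green_L_block_iff using f h f_sub h_sub by blast
    moreover have "(h, g) \<in> green_R S"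
      unfolding green_R_block_iff
      using h g ker full_transf_green_R_imp_same_kernel[OF R\<gamma>] by (simp add: \<chi>h)
    ultimately show "(f, g) \<in> green_D S"
      unfolding green_D_def by blast
  qed
qed

end
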